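(* Let $F\in\mathcal{H}^d$ and $A=\mathcal{A}(F)$. If there exists $\mathbf{b}\in\Delta^d_{++}$ such that $A^T\mathbf{b}=\mathbf{b}$, then there exist $\mathbf{u}\in\mathcal{S}_+$ and $\boldsymbol{\lambda}\in\mathbb{R}^d_+$ such that $F(\mathbf{u})=\boldsymbol{\lambda}\otimes\mathbf{u}$ and $$\sup_{\mathbf{x}\in\mathcal{K}_{+,0}}\limsup_{m\to\infty}\prod_{i=1}^d\|F^m_i(\mathbf{x})\|_{\gamma_i}^{b_i/m}=\prod_{i=1}^d\lambda_i^{b_i}=\lim_{m\to\infty}\sup_{\mathbf{x}\in\mathcal{S}_+}\prod_{i=1}^d\|F^m_i(\mathbf{x})\|_{\gamma_i}^{b_i/m}.$$ Moreover, $$\prod_{i=1}^d\lambda_i^{b_i}=\lim_{m\to\infty}\Big(\prod_{i=1}^d\|F^m_i(\mathbf{x})\|_{\gamma_i}^{b_i}\Big)^{1/m}\qquad\forall\mathbf{x}\in\mathcal{K}_{++},$$ and for every $\mathbf{y}\in\mathcal{S}_+$ and $\boldsymbol{\theta}\in\mathbb{R}^d_+$ such that $\boldsymbol{\theta}\otimes\mathbf{y}\le F(\mathbf{y})$, it holds $$\prod_{i=1}^d\theta_i^{b_i}\le\prod_{i=1}^d\lambda_i^{b_i}.$$ Finally, if $F$ is irreducible, then $\mathbf{u}\in\mathcal{K}_{++}$.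
   Context: Fix positive integers $d,n_1,\ldots,n_d$. Let $\mathcal{K}_+=\mathbb{R}^{n_1}_+\times\cdots\times\mathbb{R}^{n_d}_+$ (nonnegative entries), $\mathcal{K}_{+,0}=(\mathbb{R}^{n_1}_+\setminus\{0\})\times\cdots\times(\mathbb{R}^{n_d}_+\setminus\{0\})$, $\mathcal{K}_{++}=\mathbb{R}^{n_1}_{++}\times\cdots\times\mathbb{R}^{n_d}_{++}$ (positive entries), $\Delta^d_{++}=\{\mathbf{z}\in\mathbb{R}^d_{++}:\sum_i z_i=1\}$. Write $\mathbf{x}=(\mathbf{x}_1,\ldots,\mathbf{x}_d)$ with $\mathbf{x}_i\in\mathbb{R}^{n_i}$, $F=(F_1,\ldots,F_d)$, and $F^m=(F^m_1,\ldots,F^m_d)$ for the $m$-th iterate of $F$. $\mathbf{x}\le\mathbf{y}$ means $\mathbf{y}-\mathbf{x}\in\mathcal{K}_+$. For $\boldsymbol{\alpha}\in\mathbb{R}^d$, $\boldsymbol{\alpha}\otimes\mathbf{x}=(\alpha_1\mathbf{x}_1,\ldots,\alpha_d\mathbf{x}_d)$. For $\boldsymbol{\alpha}\in\mathbb{R}^d_{++}$ and $B\in\mathbb{R}^{d\times d}$, $\boldsymbol{\alpha}^B=(\prod_{k}\alpha_k^{B_{1,k}},\ldots,\prod_k\alpha_k^{B_{d,k}})$. $\mathbf{1}$ is the vector of all ones. $F\colon\mathcal{K}_+\to\mathcal{K}_+$ is order-preserving if $\mathbf{x}\le\mathbf{y}$ implies $F(\mathbf{x})\le F(\mathbf{y})$;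 it is multi-homogeneous with homogeneity matrix $\mathcal{A}(F)=A\in\mathbb{R}^{d\times d}$ if $F(\boldsymbol{\alpha}\otimes\mathbf{x})=\boldsymbol{\alpha}^A\otimes F(\mathbf{x})$ for all $\mathbf{x}\in\mathcal{K}_+$, $\boldsymbol{\alpha}\in\mathbb{R}^d_{++}$. $\mathcal{H}^d$ is the set of $F\colon\mathcal{K}_+\to\mathcal{K}_+$ that are continuous, order-preserving and multi-homogeneous, with $F(\mathbf{1})\in\mathcal{K}_{++}$ and such that $\mathcal{A}(F)$ has at least one nonzero entry per row. A continuous, multi-homogeneous, order-preserving $F\colon\mathcal{K}_+\to\mathcal{K}_+$ is irreducible if for every $\mathbf{x}\in\mathcal{K}_{+,0}$ there exists a positive integer $m$ such that $H^m(\mathbf{x})\in\mathcal{K}_{++}$, where $H(\mathbf{x})=\mathbf{x}+F(\mathbf{x})$ and $H^m$ is the $m$-th iterate of $H$. For each $i$, $\|\cdot\|_{\gamma_i}$ is a norm on $\mathbb{R}^{n_i}$, assumed monotonic ($0\le\mathbf{x}_i\le\mathbf{y}_i$ implies $\|\mathbf{x}_i\|_{\gamma_i}\le\|\mathbf{y}_i\|_{\gamma_i}$), and $\mathcal{S}_+=\{\mathbf{x}\in\mathcal{K}_+:\|\mathbf{x}_i\|_{\gamma_i}=1,\ i=1,\ldots,d\}$. *)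

theory Defs
  imports "HOL-Analysis.Analysis"
begin

text \<open>
  A product of spaces R^(n_i), with i ranging over the finite index type 'd (so d = CARD('d)),
  is realised inside \<^typ>\<open>real^'n^'d\<close>. The coordinates of the i-th factor are
  indexed by a nonempty set \<^term>\<open>J i\<close> of elements of the finite type 'n, so
  n_i = card (J i); all entries outside \<^term>\<open>J i\<close> are 0. The i-th block of x is
  x $ i. As 'n, 'd and J are arbitrary, every choice of positive d, n_1, ..., n_d arises.
\<close>

definition block_space :: "'n::finite set \<Rightarrow> (real^'n) set" where
  "block_space I = {v. \<forall>j. j \<notin> I \<longrightarrow> v $ j = 0}"

definition Kplus :: "('d::finite \<Rightarrow> 'n::finite set) \<Rightarrow> (real^'n^'d) set" where
  "Kplus J = {x. \<forall>i. x $ i \<in> block_space (J i) \<and> (\<forall>j\<in>J i. 0 \<le> x $ i $ j)}"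

definition Kplus0 :: "('d::finite \<Rightarrow> 'n::finite set) \<Rightarrow> (real^'n^'d) set" where
  "Kplus0 J = {x \<in> Kplus J. \<forall>i. x $ i \<noteq> 0}"

definition Kpos :: "('d::finite \<Rightarrow> 'n::finite set) \<Rightarrow> (real^'n^'d) set" where
  "Kpos J = {x. \<forall>i. x $ i \<in> block_space (J i) \<and> (\<forall>j\<in>J i. 0 < x $ i $ j)}"

definition pos_simplex :: "(real^'d::finite) set" where
  "pos_simplex = {z. (\<forall>i. 0 < z $ i) \<and> (\<Sum>i\<in>UNIV. z $ i) = 1}"

definition ones :: "('d::finite \<Rightarrow> 'n::finite set) \<Rightarrow> real^'n^'d" where
  "ones J = (\<chi> i j. if j \<in> J i then 1 else 0)"

definition block_scale :: "real^'d::finite \<Rightarrow> real^'n::finite^'d \<Rightarrow> real^'n^'d" where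
  "block_scale \<alpha> x = (\<chi> i. \<alpha> $ i *\<^sub>R x $ i)"

definition vec_powr :: "real^'d::finite \<Rightarrow> real^'d^'d \<Rightarrow> real^'d" where
  "vec_powr \<alpha> B = (\<chi> i. \<Prod>k\<in>UNIV. \<alpha> $ k powr B $ i $ k)"

text \<open>
  The order on \<^typ>\<open>real^'n^'d\<close> is componentwise, so for points of \<^term>\<open>Kplus J\<close>
  the relation x \<le> y says exactly that y - x lies in \<^term>\<open>Kplus J\<close>.
\<close>

lemma le_iff_diff_in_Kplus:
  assumes "x \<in> Kplus J" "y \<in> Kplus J"
  shows "x \<le> y \<longleftrightarrow> y - x \<in> Kplus J"
  using assms by (force simp: Kplus_def block_space_def less_eq_vec_def)

definition order_preserving ::
  "('d::finite \<Rightarrow> 'n::finite set) \<Rightarrow> (real^'n^'d \<Rightarrow> real^'n^'d) \<Rightarrow> bool" where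
  "order_preserving J F \<longleftrightarrow> (\<forall>x\<in>Kplus J. \<forall>y\<in>Kplus J. x \<le> y \<longrightarrow> F x \<le> F y)"

definition multi_homogeneous ::
  "('d::finite \<Rightarrow> 'n::finite set) \<Rightarrow> (real^'n^'d \<Rightarrow> real^'n^'d) \<Rightarrow> real^'d^'d \<Rightarrow> bool" where
  "multi_homogeneous J F A \<longleftrightarrow>
     (\<forall>x\<in>Kplus J. \<forall>\<alpha>. (\<forall>i. 0 < \<alpha> $ i) \<longrightarrow>
        F (block_scale \<alpha> x) = block_scale (vec_powr \<alpha> A) (F x))"

definition multi_homogeneous_maps ::
  "('d::finite \<Rightarrow> 'n::finite set) \<Rightarrow> (real^'n^'d \<Rightarrow> real^'n^'d) set" where
  "multi_homogeneous_maps J =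
     {F. F ` Kplus J \<subseteq> Kplus J \<and> continuous_on (Kplus J) F \<and> order_preserving J F \<and>
         F (ones J) \<in> Kpos J \<and>
         (\<exists>A. multi_homogeneous J F A \<and> (\<forall>i. \<exists>k. A $ i $ k \<noteq> 0))}"

text \<open>
  For maps in \<^term>\<open>multi_homogeneous_maps J\<close> the homogeneity matrix is unique, so it may
  be given as any A with \<^term>\<open>multi_homogeneous J F A\<close>.
\<close>

lemma homogeneity_matrix_unique:
  fixes J :: "'d::finite \<Rightarrow> 'n::finite set"
  assumes J: "\<And>i. J i \<noteq> {}"
    and F: "F (ones J) \<in> Kpos J"
    and A: "multi_homogeneous J F A" and B: "multi_homogeneous J F B"
  shows "A = B"
proof -
  have "A $ i $ l = B $ i $ l" for i l
  proof -
    define \<alpha> :: "real^'d" where "\<alpha> = (\<chi> k. if k = l then exp 1 else 1)"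
    have pos: "\<forall>k. 0 < \<alpha> $ k" by (simp add: \<alpha>_def)
    have in_K: "ones J \<in> Kplus J"
      by (auto simp: ones_def Kplus_def block_space_def)
    have eq: "block_scale (vec_powr \<alpha> A) (F (ones J)) = block_scale (vec_powr \<alpha> B) (F (ones J))"
      using A B pos in_K unfolding multi_homogeneous_def by metis
    obtain j where j: "j \<in> J i" using J by blast
    have "0 < F (ones J) $ i $ j" using F j by (auto simp: Kpos_def)
    moreover have "vec_powr \<alpha> A $ i * F (ones J) $ i $ j = vec_powr \<alpha> B $ i * F (ones J) $ i $ j"
      using arg_cong[OF eq, of "\<lambda>v. v $ i $ j"] by (simp add: block_scale_def)
    ultimately have "vec_powr \<alpha> A $ i = vec_powr \<alpha> B $ i" by simp
    moreover have "vec_powr \<alpha> C $ i = exp (C $ i $ l)" for C :: "real^'d^'d"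
    proof -
      have "vec_powr \<alpha> C $ i = (\<Prod>k\<in>UNIV. if k = l then exp (C $ i $ l) else 1)"
        unfolding vec_powr_def vec_lambda_beta
        by (rule prod.cong) (auto simp: \<alpha>_def powr_def)
      then show ?thesis by simp
    qed
    ultimately show ?thesis by simp
  qed
  then show ?thesis by (simp add: vec_eq_iff)
qed

definition irreducible_map ::
  "('d::finite \<Rightarrow> 'n::finite set) \<Rightarrow> (real^'n^'d \<Rightarrow> real^'n^'d) \<Rightarrow> bool" where
  "irreducible_map J F \<longleftrightarrow>
     (\<forall>x\<in>Kplus0 J. \<exists>m>0. ((\<lambda>z. z + F z) ^^ m) x \<in> Kpos J)"

definition is_norm_on :: "(real^'n::finite) set \<Rightarrow> (real^'n \<Rightarrow> real) \<Rightarrow> bool" where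
  "is_norm_on V N \<longleftrightarrow>
     (\<forall>v\<in>V. 0 \<le> N v \<and> (N v = 0 \<longleftrightarrow> v = 0)) \<and>
     (\<forall>v\<in>V. \<forall>c. N (c *\<^sub>R v) = \<bar>c\<bar> * N v) \<and>
     (\<forall>v\<in>V. \<forall>w\<in>V. N (v + w) \<le> N v + N w)"

definition monotonic_norm_on :: "(real^'n::finite) set \<Rightarrow> (real^'n \<Rightarrow> real) \<Rightarrow> bool" where
  "monotonic_norm_on V N \<longleftrightarrow>
     is_norm_on V N \<and> (\<forall>v\<in>V. \<forall>w\<in>V. 0 \<le> v \<and> v \<le> w \<longrightarrow> N v \<le> N w)"

definition Splus ::
  "('d::finite \<Rightarrow> 'n::finite set) \<Rightarrow> ('d \<Rightarrow> real^'n \<Rightarrow> real) \<Rightarrow> (real^'n^'d) set" where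
  "Splus J \<gamma> = {x \<in> Kplus J. \<forall>i. \<gamma> i (x $ i) = 1}"

end

theory Submission
  imports Defs
begin

text \<open>
  Write W z for the weighted geometric mean \<open>\<Prod>i. z\<^sub>i powr b\<^sub>i\<close>. It is multiplicative, and the hypothesis
  \<open>A\<^sup>T b = b\<close> says exactly that W is unchanged by the exponent map \<open>\<alpha> \<mapsto> \<alpha>\<^sup>A\<close>. Hence a one-step
  inequality \<open>F v \<le> \<theta> \<otimes> v\<close> with \<open>\<theta> > 0\<close> can be iterated: the m-th iterate of \<open>\<alpha> \<otimes> v\<close> lies below some
  \<open>\<beta> \<otimes> v\<close> with \<open>W \<beta> = (W \<theta>)^m * W \<alpha>\<close>, and likewise from below for \<open>\<theta> \<otimes> v \<le> F v\<close>. After taking m-th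
  roots the factor \<open>W \<alpha>\<close> disappears, so a positive v with \<open>F v \<le> \<theta> \<otimes> v\<close> bounds the growth of
  every orbit by \<open>W \<theta>\<close>, uniformly on order-bounded sets, while a nonzero y with \<open>\<theta> \<otimes> y \<le> F y\<close> bounds
  the growth from below for every starting point that dominates a positive multiple of y.

  It remains to find an eigenvector whose eigenvalue is met by both bounds. Brouwer's theorem on
  the product of simplices, applied to the normalised map \<open>x \<mapsto> F x + \<epsilon> 1\<close>, gives a
  positive \<open>v\<^sub>\<epsilon>\<close> with \<open>F v\<^sub>\<epsilon> \<le> F v\<^sub>\<epsilon> + \<epsilon> 1 = \<theta>\<^sub>\<epsilon> \<otimes> v\<^sub>\<epsilon>\<close>. A limit point u of \<open>v\<^sub>\<epsilon>\<close> as \<open>\<epsilon>\<close> tends to 0 satisfies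
  \<open>F u = \<lambda> \<otimes> u\<close> with \<open>W \<theta>\<^sub>\<epsilon>\<close> tending to \<open>W \<lambda>\<close>. The vectors \<open>v\<^sub>\<epsilon>\<close> thus show that no orbit grows faster
  than \<open>W \<lambda>\<close>, even if u itself lies on the boundary of the cone, and u shows that this rate is attained.
  Rescaling the blocks of u changes \<open>\<lambda>\<close> but not \<open>W \<lambda>\<close>, by the invariance of W.

  Positivity of u in the irreducible case holds because the iterates of \<open>z \<mapsto> z + F z\<close> at u are
  positive block multiples of u, so they have the same zero entries as u.
\<close>

section \<open>The cone and its order\<close>

lemma block_matrix_le_iff:
  fixes x y :: "real^'n::finite^'d::finite"
  shows "x \<le> y \<longleftrightarrow> (\<forall>i j. x $ i $ j \<le> y $ i $ j)"
  by (auto simp: less_eq_vec_def)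

lemma block_scale_nth [simp]: "block_scale \<alpha> x $ i = \<alpha> $ i *\<^sub>R x $ i"
  by (simp add: block_scale_def)

lemma block_scale_block_scale: "block_scale \<alpha> (block_scale \<beta> x) = block_scale (\<alpha> * \<beta>) x"
  by (simp add: vec_eq_iff algebra_simps)

lemma Kplus_iff:
  "x \<in> Kplus J \<longleftrightarrow> (\<forall>i j. 0 \<le> x $ i $ j \<and> (j \<notin> J i \<longrightarrow> x $ i $ j = 0))"
  by (auto simp: Kplus_def block_space_def) (metis order_refl)

lemma Kpos_iff:
  "x \<in> Kpos J \<longleftrightarrow> (\<forall>i j. (j \<in> J i \<longrightarrow> 0 < x $ i $ j) \<and> (j \<notin> J i \<longrightarrow> x $ i $ j = 0))"
  by (auto simp: Kpos_def block_space_def)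

lemma Kpos_imp_Kplus: "x \<in> Kpos J \<Longrightarrow> x \<in> Kplus J"
  unfolding Kpos_iff Kplus_iff by (metis less_imp_le order_refl)

lemma Kplus_nonneg: "x \<in> Kplus J \<Longrightarrow> 0 \<le> x $ i $ j"
  by (simp add: Kplus_iff)

lemma Kplus_block_space: "x \<in> Kplus J \<Longrightarrow> x $ i \<in> block_space (J i)"
  by (simp add: Kplus_def)

lemma Kplus_block_scale:
  "x \<in> Kplus J \<Longrightarrow> \<forall>i. 0 \<le> \<alpha> $ i \<Longrightarrow> block_scale \<alpha> x \<in> Kplus J"
  by (simp add: Kplus_iff)

lemma block_scale_mono_right:
  fixes x y :: "real^'n::finite^'d::finite"
  assumes "\<forall>i. 0 \<le> \<alpha> $ i" "x \<le> y"
  shows "block_scale \<alpha> x \<le> block_scale \<alpha> y"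
  using assms by (auto simp: block_matrix_le_iff mult_left_mono)

text \<open>
  A positive v is an order unit of the cone. One common factor for all entries suffices: the sum of all
  quotients is at least each of them, and adding 1 makes it positive.
\<close>

lemma Kpos_dominates:
  fixes J :: "'d::finite \<Rightarrow> 'n::finite set"
  assumes v: "v \<in> Kpos J" and x: "x \<in> Kplus J"
  obtains t where "0 < t" "x \<le> block_scale (\<chi> i. t) v"
proof
  define q where "q = (\<lambda>(i, j). x $ i $ j / v $ i $ j)"
  have q0: "0 \<le> q p" for p
    unfolding q_def using Kplus_nonneg[OF x] Kplus_nonneg[OF Kpos_imp_Kplus[OF v]]
    by (cases p) auto
  show "0 < 1 + sum q UNIV"
    using sum_nonneg[of UNIV q] q0 by (simp add: add_pos_nonneg)
  show "x \<le> block_scale (\<chi> i. 1 + sum q UNIV) v"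
    unfolding block_matrix_le_iff
  proof (intro allI)
    fix i j
    show "x $ i $ j \<le> block_scale (\<chi> i. 1 + sum q UNIV) v $ i $ j"
    proof (cases "j \<in> J i")
      case True
      then have pos: "0 < v $ i $ j" using v by (simp add: Kpos_iff)
      have "q (i, j) \<le> sum q UNIV"
        by (rule member_le_sum) (auto simp: q0)
      then have "q (i, j) \<le> 1 + sum q UNIV" by simp
      then show ?thesis using pos by (simp add: q_def field_simps)
    next
      case False
      then show ?thesis using x v by (simp add: Kplus_iff Kpos_iff)
    qed
  qed
qed

section \<open>The weighted geometric mean\<close>

definition weighted_prod :: "real^'d::finite \<Rightarrow> real^'d \<Rightarrow> real" where
  "weighted_prod b z = (\<Prod>i\<in>UNIV. z $ i powr b $ i)"

lemma weighted_prod_mult: "weighted_prod b (x * y) = weighted_prod b x * weighted_prod b y"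
  by (simp add: weighted_prod_def powr_mult prod.distrib)

lemma weighted_prod_nonneg: "0 \<le> weighted_prod b x"
  by (simp add: weighted_prod_def prod_nonneg)

lemma weighted_prod_pos: "\<forall>i. 0 < x $ i \<Longrightarrow> 0 < weighted_prod b x"
  by (auto simp: weighted_prod_def intro!: prod_pos) (metis less_irrefl)

lemma weighted_prod_one: "\<forall>i. x $ i = 1 \<Longrightarrow> weighted_prod b x = 1"
  by (simp add: weighted_prod_def)

lemma weighted_prod_eq_0: "x $ i = 0 \<Longrightarrow> weighted_prod b x = 0"
  unfolding weighted_prod_def by (rule prod_zero) auto

lemma weighted_prod_mono:
  assumes "\<forall>i. 0 \<le> b $ i" "\<forall>i. 0 \<le> x $ i" "x \<le> y"
  shows "weighted_prod b x \<le> weighted_prod b y"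
  unfolding weighted_prod_def using assms
  by (intro prod_mono) (auto simp: less_eq_vec_def intro!: powr_mono2)

text \<open>
  Exchanging the two products turns the exponent of \<open>\<beta>\<^sub>k\<close> into \<open>\<Sum>i. A\<^sub>i\<^sub>k b\<^sub>i\<close>, the k-th entry of \<open>A\<^sup>T b\<close>.
\<close>

lemma weighted_prod_vec_powr:
  assumes fixed: "transpose A *v b = b" and pos: "\<forall>i. 0 < \<beta> $ i"
  shows "weighted_prod b (vec_powr \<beta> A) = weighted_prod b \<beta>"
proof -
  have "weighted_prod b (vec_powr \<beta> A)
      = (\<Prod>i\<in>UNIV. \<Prod>k\<in>UNIV. \<beta> $ k powr (A $ i $ k * b $ i))"
    by (simp add: weighted_prod_def vec_powr_def prod_powr_distrib powr_powr)
  also have "\<dots> = (\<Prod>k\<in>UNIV. \<Prod>i\<in>UNIV. \<beta> $ k powr (A $ i $ k * b $ i))"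
    by (rule prod.swap)
  also have "\<dots> = (\<Prod>k\<in>UNIV. \<beta> $ k powr (\<Sum>i\<in>UNIV. A $ i $ k * b $ i))"
    using pos by (intro prod.cong refl powr_sum[symmetric]) (metis less_irrefl)
  also have "\<dots> = (\<Prod>k\<in>UNIV. \<beta> $ k powr (transpose A *v b) $ k)"
    by (simp add: matrix_vector_mult_def transpose_def)
  finally show ?thesis unfolding fixed by (simp add: weighted_prod_def)
qed

lemma vec_powr_pos: "\<forall>i. 0 < \<beta> $ i \<Longrightarrow> 0 < vec_powr \<beta> A $ i"
  by (auto simp: vec_powr_def intro!: prod_pos) (metis less_irrefl)

lemma tendsto_weighted_prod:
  assumes lim: "z \<longlonglongrightarrow> l" and b: "\<forall>i. 0 < b $ i" and nonneg: "\<And>n i. 0 \<le> z n $ i"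
  shows "(\<lambda>n. weighted_prod b (z n)) \<longlonglongrightarrow> weighted_prod b l"
  unfolding weighted_prod_def
proof (intro tendsto_prod)
  fix i
  show "(\<lambda>n. z n $ i powr b $ i) \<longlonglongrightarrow> l $ i powr b $ i"
    using tendsto_vec_nth[OF lim] b nonneg by (intro tendsto_powr') auto
qed

text \<open>Multiplicative constants do not affect an exponential growth rate.\<close>

lemma tendsto_root_power_mult:
  fixes w c :: real
  assumes "0 \<le> w" "0 < c"
  shows "(\<lambda>m. (w ^ m * c) powr (1 / real m)) \<longlonglongrightarrow> w"
proof -
  have "(\<lambda>m. w * c powr (1 / real m)) \<longlonglongrightarrow> w * c powr 0"
    using assms by (intro tendsto_intros lim_1_over_n) auto
  moreover have "\<forall>\<^sub>F m in sequentially. w * c powr (1 / real m) = (w ^ m * c) powr (1 / real m)"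
    using eventually_gt_at_top[of 0]
  proof eventually_elim
    case (elim m)
    have "(w ^ m) powr (1 / real m) = w"
    proof (cases "w = 0")
      case True
      then show ?thesis using elim by simp
    next
      case False
      then show ?thesis using assms elim by (simp add: powr_powr flip: powr_realpow)
    qed
    then show ?case by (simp add: powr_mult)
  qed
  ultimately show ?thesis using assms by (simp add: tendsto_cong)
qed

section \<open>The product of simplices\<close>

definition block_sums :: "('d::finite \<Rightarrow> 'n::finite set) \<Rightarrow> real^'n^'d \<Rightarrow> real^'d" where
  "block_sums J x = (\<chi> i. \<Sum>j\<in>J i. x $ i $ j)"

definition block_simplex :: "('d::finite \<Rightarrow> 'n::finite set) \<Rightarrow> (real^'n^'d) set" where
  "block_simplex J = {x \<in> Kplus J. \<forall>i. block_sums J x $ i = 1}"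

lemma block_sums_block_scale: "block_sums J (block_scale \<alpha> x) = \<alpha> * block_sums J x"
  by (simp add: block_sums_def vec_eq_iff sum_distrib_left)

lemma block_simplex_nonzero:
  assumes "x \<in> block_simplex J"
  shows "x $ i \<noteq> 0"
proof
  assume "x $ i = 0"
  then have "block_sums J x $ i = 0" by (simp add: block_sums_def)
  then show False using assms by (simp add: block_simplex_def)
qed

lemma compact_block_simplex:
  fixes J :: "'d::finite \<Rightarrow> 'n::finite set"
  shows "compact (block_simplex J)"
proof -
  have "x \<le> ones J" if x: "x \<in> block_simplex J" for x
    unfolding block_matrix_le_iff
  proof (intro allI)
    fix i j
    have K: "x \<in> Kplus J" using x by (simp add: block_simplex_def)
    show "x $ i $ j \<le> ones J $ i $ j"
    proof (cases "j \<in> J i")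
      case True
      have "x $ i $ j \<le> block_sums J x $ i"
        unfolding block_sums_def vec_lambda_beta
        using True Kplus_nonneg[OF K] by (intro member_le_sum) auto
      then show ?thesis using x True by (simp add: block_simplex_def ones_def)
    next
      case False
      then show ?thesis using K by (simp add: Kplus_iff ones_def)
    qed
  qed
  then have sub: "block_simplex J \<subseteq> {0..ones J}"
    by (auto simp: block_simplex_def block_matrix_le_iff Kplus_iff)
  have "closed {x :: real^'n^'d. \<forall>i. (\<forall>j. 0 \<le> x $ i $ j \<and> (j \<notin> J i \<longrightarrow> x $ i $ j = 0)) \<and>
      (\<Sum>j\<in>J i. x $ i $ j) = 1}"
    by (intro closed_Collect_all closed_Collect_conj closed_Collect_imp closed_Collect_le
        closed_Collect_eq open_Collect_const continuous_intros)
  also have "{x. \<forall>i. (\<forall>j. 0 \<le> x $ i $ j \<and> (j \<notin> J i \<longrightarrow> x $ i $ j = 0)) \<and>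
      (\<Sum>j\<in>J i. x $ i $ j) = 1} = block_simplex J"
    by (auto simp: block_simplex_def Kplus_iff block_sums_def)
  finally show ?thesis
    using sub compact_Int_closed[OF compact_interval[of 0 "ones J"]] by (metis inf.absorb2)
qed

lemma convex_block_simplex: "convex (block_simplex J)"
proof (rule convexI)
  fix x y and s t :: real
  assume x: "x \<in> block_simplex J" and y: "y \<in> block_simplex J"
    and st: "0 \<le> s" "0 \<le> t" "s + t = 1"
  have "block_sums J (s *\<^sub>R x + t *\<^sub>R y) = s *\<^sub>R block_sums J x + t *\<^sub>R block_sums J y"
    by (simp add: block_sums_def vec_eq_iff sum.distrib sum_distrib_left)
  then show "s *\<^sub>R x + t *\<^sub>R y \<in> block_simplex J"
    using x y st by (simp add: block_simplex_def Kplus_iff)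
qed

lemma ones_Kpos: "ones J \<in> Kpos J"
  by (auto simp: Kpos_iff ones_def)

lemma block_sums_pos:
  assumes "\<And>i. J i \<noteq> {}" "x \<in> Kpos J"
  shows "0 < block_sums J x $ i"
  using assms by (auto simp: block_sums_def Kpos_iff intro!: sum_pos)

lemma normalised_in_block_simplex:
  assumes J: "\<And>i. J i \<noteq> {}" and x: "x \<in> Kpos J"
  shows "block_scale (\<chi> i. 1 / block_sums J x $ i) x \<in> block_simplex J"
proof -
  have "block_sums J (block_scale (\<chi> i. 1 / block_sums J x $ i) x) $ i = 1" for i
    using block_sums_pos[OF J x, of i] by (simp add: block_sums_block_scale)
  then show ?thesis
    using block_sums_pos[OF J x] Kpos_imp_Kplus[OF x]
    by (auto simp: block_simplex_def intro!: Kplus_block_scale less_imp_le)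
qed

section \<open>Monotonic norms of blocks\<close>

definition block_norms :: "('d::finite \<Rightarrow> real^'n::finite \<Rightarrow> real) \<Rightarrow> real^'n^'d \<Rightarrow> real^'d" where
  "block_norms \<gamma> x = (\<chi> i. \<gamma> i (x $ i))"

locale block_normed_cone =
  fixes J :: "'d::finite \<Rightarrow> 'n::finite set"
    and \<gamma> :: "'d \<Rightarrow> real^'n \<Rightarrow> real"
  assumes nonempty: "J i \<noteq> {}"
    and norms: "monotonic_norm_on (block_space (J i)) (\<gamma> i)"
begin

lemma block_norms_nonneg: "x \<in> Kplus J \<Longrightarrow> 0 \<le> block_norms \<gamma> x $ i"
  using norms[of i] Kplus_block_space[of x J i]
  by (auto simp: block_norms_def monotonic_norm_on_def is_norm_on_def)

lemma block_norms_pos: "x \<in> Kplus J \<Longrightarrow> x $ i \<noteq> 0 \<Longrightarrow> 0 < block_norms \<gamma> x $ i"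
  using norms[of i] Kplus_block_space[of x J i]
  by (fastforce simp: block_norms_def monotonic_norm_on_def is_norm_on_def less_le)

lemma block_norms_mono:
  assumes "x \<in> Kplus J" "y \<in> Kplus J" "x \<le> y"
  shows "block_norms \<gamma> x \<le> block_norms \<gamma> y"
proof -
  have "0 \<le> x $ i" "x $ i \<le> y $ i" for i
    using assms by (auto simp: less_eq_vec_def Kplus_iff)
  then show ?thesis
    using norms Kplus_block_space[OF assms(1)] Kplus_block_space[OF assms(2)]
    by (simp add: block_norms_def monotonic_norm_on_def less_eq_vec_def[of "vec_lambda _"])
qed

lemma block_norms_block_scale:
  assumes "x \<in> Kplus J" "\<forall>i. 0 \<le> \<alpha> $ i"
  shows "block_norms \<gamma> (block_scale \<alpha> x) = \<alpha> * block_norms \<gamma> x"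
  using assms norms Kplus_block_space[of x J]
  by (auto simp: block_norms_def monotonic_norm_on_def is_norm_on_def vec_eq_iff)

lemma Splus_iff: "x \<in> Splus J \<gamma> \<longleftrightarrow> x \<in> Kplus J \<and> (\<forall>i. block_norms \<gamma> x $ i = 1)"
  by (auto simp: Splus_def block_norms_def)

lemma Splus_subset_Kplus0: "Splus J \<gamma> \<subseteq> Kplus0 J"
proof
  fix x assume x: "x \<in> Splus J \<gamma>"
  have "x $ i \<noteq> 0" for i
  proof
    assume "x $ i = 0"
    moreover have "x $ i \<in> block_space (J i)"
      using x Kplus_block_space by (auto simp: Splus_def)
    ultimately have "\<gamma> i (x $ i) = 0"
      using norms[of i] by (auto simp: monotonic_norm_on_def is_norm_on_def)
    then show False using x by (auto simp: Splus_def)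
  qed
  then show "x \<in> Kplus0 J" using x by (auto simp: Kplus0_def Splus_def)
qed

text \<open>
  Monotonicity gives \<open>x\<^sub>i\<^sub>j * \<gamma>\<^sub>i e\<^sub>j \<le> \<gamma>\<^sub>i x\<^sub>i\<close>, so the entries on the unit sphere are bounded by the
  reciprocals of the norms of the unit vectors.
\<close>

lemma Splus_bounded_above:
  obtains M where "M \<in> Kplus J" "\<And>x. x \<in> Splus J \<gamma> \<Longrightarrow> x \<le> M"
proof
  define M :: "real^'n^'d" where "M = (\<chi> i j. if j \<in> J i then 1 / \<gamma> i (axis j 1) else 0)"
  have axis_in: "axis j 1 \<in> block_space (J i)" if "j \<in> J i" for i j
    using that by (auto simp: block_space_def axis_def)
  have norm_pos: "0 < \<gamma> i (axis j 1)" if "j \<in> J i" for i j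
  proof -
    have "axis j (1::real) \<noteq> 0" by (simp add: axis_eq_0_iff)
    then have "0 \<le> \<gamma> i (axis j 1)" "\<gamma> i (axis j 1) \<noteq> 0"
      using norms[of i] axis_in[OF that] by (auto simp: monotonic_norm_on_def is_norm_on_def)
    then show ?thesis by simp
  qed
  show "M \<in> Kplus J"
    using norm_pos by (auto simp: Kplus_iff M_def intro!: less_imp_le)
  fix x assume x: "x \<in> Splus J \<gamma>"
  then have K: "x \<in> Kplus J" by (simp add: Splus_def)
  show "x \<le> M"
    unfolding block_matrix_le_iff
  proof (intro allI)
    fix i j
    show "x $ i $ j \<le> M $ i $ j"
    proof (cases "j \<in> J i")
      case True
      let ?e = "x $ i $ j *\<^sub>R axis j 1 :: real^'n"
      have "?e \<in> block_space (J i)" "0 \<le> ?e" "?e \<le> x $ i"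
        using axis_in[OF True] Kplus_nonneg[OF K]
        by (auto simp: block_space_def less_eq_vec_def axis_def)
      then have "\<gamma> i ?e \<le> \<gamma> i (x $ i)"
        using norms[of i] Kplus_block_space[OF K] by (simp add: monotonic_norm_on_def)
      moreover have "\<gamma> i ?e = x $ i $ j * \<gamma> i (axis j 1)"
        using norms[of i] axis_in[OF True] Kplus_nonneg[OF K]
        by (simp add: monotonic_norm_on_def is_norm_on_def)
      ultimately show ?thesis
        using x True norm_pos[OF True] by (simp add: Splus_def M_def field_simps)
    next
      case False
      then show ?thesis using K by (simp add: Kplus_iff M_def)
    qed
  qed
qed

end

section \<open>Iterating sub- and supersolutions\<close>

locale multi_homogeneous_dynamics = block_normed_cone J \<gamma>
  for J :: "'d::finite \<Rightarrow> 'n::finite set" and \<gamma> :: "'d \<Rightarrow> real^'n \<Rightarrow> real" +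
  fixes F :: "real^'n^'d \<Rightarrow> real^'n^'d" and A :: "real^'d^'d" and b :: "real^'d"
  assumes maps: "x \<in> Kplus J \<Longrightarrow> F x \<in> Kplus J"
    and cont: "continuous_on (Kplus J) F"
    and mono: "x \<in> Kplus J \<Longrightarrow> y \<in> Kplus J \<Longrightarrow> x \<le> y \<Longrightarrow> F x \<le> F y"
    and homog: "x \<in> Kplus J \<Longrightarrow> \<forall>i. 0 < \<alpha> $ i \<Longrightarrow>
      F (block_scale \<alpha> x) = block_scale (vec_powr \<alpha> A) (F x)"
    and b_pos: "0 < b $ i"
    and b_fixed: "transpose A *v b = b"
begin

lemma iterate_in_Kplus: "x \<in> Kplus J \<Longrightarrow> (F ^^ m) x \<in> Kplus J"
  by (induction m) (auto simp: maps)

text \<open>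
  One step replaces \<open>\<beta>\<close> by \<open>\<beta>\<^sup>A * \<theta>\<close>, which multiplies the weighted geometric mean by that of \<open>\<theta>\<close>.
\<close>

lemma supersolution_iterate:
  assumes v: "v \<in> Kplus J" and \<theta>: "\<forall>i. 0 < \<theta> $ i" and super: "F v \<le> block_scale \<theta> v"
    and x: "x \<in> Kplus J" and \<alpha>: "\<forall>i. 0 < \<alpha> $ i" and le: "x \<le> block_scale \<alpha> v"
  shows "\<exists>\<beta>. (\<forall>i. 0 < \<beta> $ i) \<and> weighted_prod b \<beta> = weighted_prod b \<theta> ^ m * weighted_prod b \<alpha> \<and>
    (F ^^ m) x \<le> block_scale \<beta> v"
proof (induction m)
  case 0
  then show ?case using \<alpha> le by auto
next
  case (Suc m)
  then obtain \<beta> where \<beta>: "\<forall>i. 0 < \<beta> $ i" "(F ^^ m) x \<le> block_scale \<beta> v"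
    and W: "weighted_prod b \<beta> = weighted_prod b \<theta> ^ m * weighted_prod b \<alpha>" by blast
  have "(F ^^ Suc m) x \<le> F (block_scale \<beta> v)"
    using \<beta> x v by (auto simp: less_imp_le intro!: mono iterate_in_Kplus Kplus_block_scale)
  also have "\<dots> = block_scale (vec_powr \<beta> A) (F v)"
    by (rule homog[OF v \<beta>(1)])
  also have "\<dots> \<le> block_scale (vec_powr \<beta> A) (block_scale \<theta> v)"
    using super vec_powr_pos[OF \<beta>(1)] by (auto simp: less_imp_le intro!: block_scale_mono_right)
  finally have "(F ^^ Suc m) x \<le> block_scale (vec_powr \<beta> A * \<theta>) v"
    by (simp add: block_scale_block_scale)
  moreover have "weighted_prod b (vec_powr \<beta> A * \<theta>) = weighted_prod b \<theta> ^ Suc m * weighted_prod b \<alpha>"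
    by (simp add: weighted_prod_mult weighted_prod_vec_powr[OF b_fixed \<beta>(1)] W)
  moreover have "\<forall>i. 0 < (vec_powr \<beta> A * \<theta>) $ i"
    using vec_powr_pos[OF \<beta>(1)] \<theta> by simp
  ultimately show ?case by blast
qed

lemma subsolution_iterate:
  assumes v: "v \<in> Kplus J" and \<theta>: "\<forall>i. 0 < \<theta> $ i" and sub: "block_scale \<theta> v \<le> F v"
    and x: "x \<in> Kplus J" and \<alpha>: "\<forall>i. 0 < \<alpha> $ i" and le: "block_scale \<alpha> v \<le> x"
  shows "\<exists>\<beta>. (\<forall>i. 0 < \<beta> $ i) \<and> weighted_prod b \<beta> = weighted_prod b \<theta> ^ m * weighted_prod b \<alpha> \<and>
    block_scale \<beta> v \<le> (F ^^ m) x"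
proof (induction m)
  case 0
  then show ?case using \<alpha> le by auto
next
  case (Suc m)
  then obtain \<beta> where \<beta>: "\<forall>i. 0 < \<beta> $ i" "block_scale \<beta> v \<le> (F ^^ m) x"
    and W: "weighted_prod b \<beta> = weighted_prod b \<theta> ^ m * weighted_prod b \<alpha>" by blast
  have "block_scale (vec_powr \<beta> A * \<theta>) v = block_scale (vec_powr \<beta> A) (block_scale \<theta> v)"
    by (simp add: block_scale_block_scale)
  also have "\<dots> \<le> block_scale (vec_powr \<beta> A) (F v)"
    using sub vec_powr_pos[OF \<beta>(1)] by (auto simp: less_imp_le intro!: block_scale_mono_right)
  also have "\<dots> = F (block_scale \<beta> v)"
    by (rule homog[OF v \<beta>(1), symmetric])
  also have "\<dots> \<le> (F ^^ Suc m) x"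
    using \<beta> x v by (auto simp: less_imp_le intro!: mono iterate_in_Kplus Kplus_block_scale)
  finally have "block_scale (vec_powr \<beta> A * \<theta>) v \<le> (F ^^ Suc m) x" .
  moreover have "weighted_prod b (vec_powr \<beta> A * \<theta>) = weighted_prod b \<theta> ^ Suc m * weighted_prod b \<alpha>"
    by (simp add: weighted_prod_mult weighted_prod_vec_powr[OF b_fixed \<beta>(1)] W)
  moreover have "\<forall>i. 0 < (vec_powr \<beta> A * \<theta>) $ i"
    using vec_powr_pos[OF \<beta>(1)] \<theta> by simp
  ultimately show ?case by blast
qed

section \<open>Growth rates\<close>

definition growth_rate :: "nat \<Rightarrow> real^'n^'d \<Rightarrow> real" where
  "growth_rate m x = weighted_prod b (block_norms \<gamma> ((F ^^ m) x)) powr (1 / real m)"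

lemma growth_rate_nonneg: "0 \<le> growth_rate m x"
  by (simp add: growth_rate_def)

lemma growth_rate_eq_prod:
  "growth_rate m x = (\<Prod>i\<in>UNIV. \<gamma> i ((F ^^ m) x $ i) powr (b $ i / real m))"
  by (simp add: growth_rate_def weighted_prod_def block_norms_def prod_powr_distrib powr_powr)

text \<open>The bound holds uniformly on the order interval below M, because M fixes the factor \<open>\<alpha>\<close>.\<close>

lemma growth_rate_le:
  assumes v: "v \<in> Kpos J" and \<theta>: "\<forall>i. 0 < \<theta> $ i" and super: "F v \<le> block_scale \<theta> v"
    and M: "M \<in> Kplus J" and c: "weighted_prod b \<theta> < c"
  shows "\<forall>\<^sub>F m in sequentially. \<forall>x\<in>Kplus J. x \<le> M \<longrightarrow> growth_rate m x \<le> c"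
proof -
  have vK: "v \<in> Kplus J" by (rule Kpos_imp_Kplus[OF v])
  obtain t where t: "0 < t" "M \<le> block_scale (\<chi> i. t) v"
    using Kpos_dominates[OF v M] .
  define C where "C = weighted_prod b (\<chi> i. t) * weighted_prod b (block_norms \<gamma> v)"
  have "v $ i \<noteq> 0" for i
  proof -
    obtain j where "j \<in> J i" using nonempty[of i] by blast
    then have "0 < v $ i $ j" using v by (simp add: Kpos_iff)
    then show ?thesis by auto
  qed
  then have "0 < C"
    unfolding C_def using t(1) block_norms_pos[OF vK] by (intro mult_pos_pos weighted_prod_pos) auto
  then have "(\<lambda>m. (weighted_prod b \<theta> ^ m * C) powr (1 / real m)) \<longlonglongrightarrow> weighted_prod b \<theta>"
    by (intro tendsto_root_power_mult weighted_prod_nonneg)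
  from order_tendstoD(2)[OF this c] show ?thesis
  proof eventually_elim
    case (elim m)
    have "growth_rate m x \<le> (weighted_prod b \<theta> ^ m * C) powr (1 / real m)"
      if x: "x \<in> Kplus J" "x \<le> M" for x
    proof -
      obtain \<beta> where \<beta>: "\<forall>i. 0 < \<beta> $ i" "(F ^^ m) x \<le> block_scale \<beta> v"
        "weighted_prod b \<beta> = weighted_prod b \<theta> ^ m * weighted_prod b (\<chi> i. t)"
        using supersolution_iterate[OF vK \<theta> super x(1), of "\<chi> i. t" m] t order_trans[OF x(2)]
        by auto
      have "block_norms \<gamma> ((F ^^ m) x) \<le> block_norms \<gamma> (block_scale \<beta> v)"
        using \<beta> x vK by (auto simp: less_imp_le intro!: block_norms_mono iterate_in_Kplus Kplus_block_scale)
      also have "\<dots> = \<beta> * block_norms \<gamma> v"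
        using \<beta> vK by (auto simp: less_imp_le intro!: block_norms_block_scale)
      finally have "weighted_prod b (block_norms \<gamma> ((F ^^ m) x)) \<le> weighted_prod b (\<beta> * block_norms \<gamma> v)"
        using b_pos block_norms_nonneg[OF iterate_in_Kplus[OF x(1)]]
        by (auto simp: less_imp_le intro!: weighted_prod_mono)
      also have "\<dots> = weighted_prod b \<theta> ^ m * C"
        by (simp add: weighted_prod_mult \<beta>(3) C_def)
      finally show ?thesis
        unfolding growth_rate_def by (intro powr_mono2) (auto simp: weighted_prod_nonneg)
    qed
    with elim show ?case by (auto intro: order_trans less_imp_le)
  qed
qed

lemma growth_rate_ge:
  assumes y: "y \<in> Kplus J" and \<theta>: "\<forall>i. 0 < \<theta> $ i" and sub: "block_scale \<theta> y \<le> F y"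
    and x: "x \<in> Kplus J" and \<alpha>: "\<forall>i. 0 < \<alpha> $ i" and le: "block_scale \<alpha> y \<le> x"
  shows "(weighted_prod b \<theta> ^ m * (weighted_prod b \<alpha> * weighted_prod b (block_norms \<gamma> y))) powr (1 / real m)
    \<le> growth_rate m x"
proof -
  obtain \<beta> where \<beta>: "\<forall>i. 0 < \<beta> $ i" "block_scale \<beta> y \<le> (F ^^ m) x"
    "weighted_prod b \<beta> = weighted_prod b \<theta> ^ m * weighted_prod b \<alpha>"
    using subsolution_iterate[OF y \<theta> sub x \<alpha> le] by blast
  have "\<beta> * block_norms \<gamma> y = block_norms \<gamma> (block_scale \<beta> y)"
    using \<beta> y by (auto simp: less_imp_le intro!: block_norms_block_scale[symmetric])
  also have "\<dots> \<le> block_norms \<gamma> ((F ^^ m) x)"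
    using \<beta> x y by (auto simp: less_imp_le intro!: block_norms_mono iterate_in_Kplus Kplus_block_scale)
  finally have "weighted_prod b (\<beta> * block_norms \<gamma> y) \<le> weighted_prod b (block_norms \<gamma> ((F ^^ m) x))"
    using b_pos \<beta>(1) block_norms_nonneg[OF y]
    by (auto simp: less_imp_le intro!: weighted_prod_mono  mult_nonneg_nonneg)
  then show ?thesis
    unfolding growth_rate_def
    by (intro powr_mono2) (auto simp: weighted_prod_mult \<beta>(3) mult.assoc weighted_prod_nonneg
        intro!: mult_nonneg_nonneg)
qed

text \<open>
  For \<open>\<theta> > 0\<close> and y on the unit sphere the constant in front of the power is 1, so the bound holds at
  every step. If some entry of \<open>\<theta>\<close> is 0, its weighted geometric mean is 0.
\<close>

lemma growth_rate_ge_Splus: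
  assumes y: "y \<in> Splus J \<gamma>" and \<theta>: "\<forall>i. 0 \<le> \<theta> $ i" and sub: "block_scale \<theta> y \<le> F y"
    and m: "0 < m"
  shows "weighted_prod b \<theta> \<le> growth_rate m y"
proof (cases "\<exists>i. \<theta> $ i = 0")
  case True
  then show ?thesis using growth_rate_nonneg weighted_prod_eq_0 by metis
next
  case False
  then have pos: "\<forall>i. 0 < \<theta> $ i" using \<theta> by (auto simp: less_le)
  have yK: "y \<in> Kplus J" using y by (simp add: Splus_def)
  have one: "block_scale 1 y = y" by (simp add: vec_eq_iff)
  have "weighted_prod b (block_norms \<gamma> y) = 1"
    using y by (auto simp: Splus_iff intro: weighted_prod_one)
  then have "(weighted_prod b \<theta> ^ m) powr (1 / real m) \<le> growth_rate m y"
    using growth_rate_ge[OF yK pos sub yK, of 1 m] one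
    by (simp add: weighted_prod_one)
  moreover have "(weighted_prod b \<theta> ^ m) powr (1 / real m) = weighted_prod b \<theta>"
    using weighted_prod_pos[OF pos, of b] m by (simp add: powr_powr flip: powr_realpow)
  ultimately show ?thesis by simp
qed

text \<open>A positive starting point dominates a positive multiple of y, so it inherits the growth from y in the limit.\<close>

lemma growth_rate_ge_Kpos:
  assumes y: "y \<in> Splus J \<gamma>" and \<theta>: "\<forall>i. 0 \<le> \<theta> $ i" and sub: "block_scale \<theta> y \<le> F y"
    and x: "x \<in> Kpos J" and c: "c < weighted_prod b \<theta>"
  shows "\<forall>\<^sub>F m in sequentially. c < growth_rate m x"
proof (cases "\<exists>i. \<theta> $ i = 0")
  case True
  then have "c < 0" using c weighted_prod_eq_0 by metis
  then have "c < growth_rate m x" for m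
    using growth_rate_nonneg[of m x] by simp
  then show ?thesis by simp
next
  case False
  then have pos: "\<forall>i. 0 < \<theta> $ i" using \<theta> by (auto simp: less_le)
  have yK: "y \<in> Kplus J" using y by (simp add: Splus_def)
  obtain t where t: "0 < t" "y \<le> block_scale (\<chi> i. t) x"
    using Kpos_dominates[OF x yK] .
  let ?\<alpha> = "\<chi> i. 1 / t :: real^'d"
  have "block_scale ?\<alpha> y \<le> block_scale ?\<alpha> (block_scale (\<chi> i. t) x)"
    using t by (intro block_scale_mono_right) auto
  also have "\<dots> = x" using t(1) by (simp add: vec_eq_iff)
  finally have le: "block_scale ?\<alpha> y \<le> x" .
  define C where "C = weighted_prod b ?\<alpha> * weighted_prod b (block_norms \<gamma> y)"
  have "0 < C"
    using y t(1) by (auto simp: C_def Splus_iff intro!: mult_pos_pos weighted_prod_pos)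
  then have "(\<lambda>m. (weighted_prod b \<theta> ^ m * C) powr (1 / real m)) \<longlonglongrightarrow> weighted_prod b \<theta>"
    by (intro tendsto_root_power_mult weighted_prod_nonneg)
  from order_tendstoD(1)[OF this c] show ?thesis
  proof eventually_elim
    case (elim m)
    also have "(weighted_prod b \<theta> ^ m * C) powr (1 / real m) \<le> growth_rate m x"
      unfolding C_def using growth_rate_ge[OF yK pos sub Kpos_imp_Kplus[OF x] _ le] t(1) by simp
    finally show ?case .
  qed
qed

section \<open>A maximal eigenvector\<close>

text \<open>
  The perturbation makes the image positive, so that the normalised map is defined and continuous on the
  whole product of simplices, and its fixed points are positive.
\<close>

lemma perturbed_eigenvector:
  assumes \<epsilon>: "0 < \<epsilon>"
  obtains v \<theta> where "v \<in> block_simplex J" "v \<in> Kpos J" "\<forall>i. 0 < \<theta> $ i"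
    "F v + \<epsilon> *\<^sub>R ones J = block_scale \<theta> v"
proof -
  let ?G = "\<lambda>x. F x + \<epsilon> *\<^sub>R ones J"
  let ?T = "\<lambda>x. block_scale (\<chi> i. 1 / block_sums J (?G x) $ i) (?G x)"
  have K: "x \<in> Kplus J" if "x \<in> block_simplex J" for x
    using that by (simp add: block_simplex_def)
  have G: "?G x \<in> Kpos J" if "x \<in> block_simplex J" for x
    using maps[OF K[OF that]] \<epsilon> by (auto simp: Kpos_iff Kplus_iff ones_def add_nonneg_pos)
  have sums_pos: "0 < block_sums J (?G x) $ i" if "x \<in> block_simplex J" for x i
    by (rule block_sums_pos[OF nonempty G[OF that]])
  have contG: "continuous_on (block_simplex J) ?G"
    using K by (intro continuous_intros continuous_on_subset[OF cont]) auto
  have contT: "continuous_on (block_simplex J) ?T"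
    unfolding block_scale_def vec_lambda_beta
  proof (intro continuous_on_vec_lambda continuous_on_scaleR continuous_on_divide continuous_on_const)
    fix i
    show "continuous_on (block_simplex J) (\<lambda>x. block_sums J (?G x) $ i)"
      unfolding block_sums_def vec_lambda_beta
      by (intro continuous_on_sum continuous_on_component contG)
    show "continuous_on (block_simplex J) (\<lambda>x. ?G x $ i)"
      by (intro continuous_on_component contG)
    show "\<forall>x\<in>block_simplex J. block_sums J (?G x) $ i \<noteq> 0"
      using sums_pos by (metis less_irrefl)
  qed
  have imT: "?T \<in> block_simplex J \<rightarrow> block_simplex J"
    by (intro Pi_I normalised_in_block_simplex nonempty G)
  have ne: "block_simplex J \<noteq> {}"
    by (rule ex_in_conv[THEN iffD1, OF exI], rule normalised_in_block_simplex[OF nonempty ones_Kpos])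
  obtain v where v: "v \<in> block_simplex J" "?T v = v"
    using brouwer[OF compact_block_simplex convex_block_simplex ne contT imT] .
  let ?\<theta> = "block_sums J (?G v)"
  have eig: "?G v = block_scale ?\<theta> v"
  proof -
    have "block_scale ?\<theta> v = block_scale ?\<theta> (?T v)" by (simp only: v(2))
    also have "\<dots> = ?G v"
      unfolding block_scale_block_scale using sums_pos[OF v(1)]
      by (simp add: vec_eq_iff less_imp_neq[symmetric])
    finally show ?thesis by simp
  qed
  have "v \<in> Kpos J"
    unfolding Kpos_iff
  proof (intro allI conjI impI)
    fix i j
    assume "j \<in> J i"
    then have "0 < ?G v $ i $ j" using G[OF v(1)] by (simp only: Kpos_iff)
    also have "\<dots> = ?\<theta> $ i * v $ i $ j" using arg_cong[OF eig, of "\<lambda>z. z $ i $ j"] by simp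
    finally show "0 < v $ i $ j"
      using sums_pos[OF v(1), of i] by (simp only: zero_less_mult_pos)
  next
    fix i j
    assume "j \<notin> J i"
    then show "v $ i $ j = 0" using K[OF v(1)] by (simp add: Kplus_iff)
  qed
  with v(1) sums_pos[OF v(1)] eig that show ?thesis by blast
qed

text \<open>
  Compactness produces the limit eigenvector. Besides the eigenvalue equation, the limit retains that
  positive supersolutions exist with growth factor arbitrarily close to that of the eigenvalue.
\<close>

lemma eigenvector_with_near_supersolutions:
  obtains u \<mu> where "u \<in> block_simplex J" "\<forall>i. 0 \<le> \<mu> $ i" "F u = block_scale \<mu> u"
    "\<And>c. weighted_prod b \<mu> < c \<Longrightarrow> \<exists>v\<in>Kpos J. \<exists>\<theta>. (\<forall>i. 0 < \<theta> $ i) \<and> F v \<le> block_scale \<theta> v \<and>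
      weighted_prod b \<theta> < c"
proof -
  let ?\<epsilon> = "\<lambda>n. inverse (real (Suc n))"
  have "\<exists>v \<theta>. v \<in> block_simplex J \<and> v \<in> Kpos J \<and> (\<forall>i. 0 < \<theta> $ i) \<and>
      F v + ?\<epsilon> n *\<^sub>R ones J = block_scale \<theta> v" for n
    using perturbed_eigenvector[of "?\<epsilon> n"] by (metis inverse_positive_iff_positive of_nat_0_less_iff zero_less_Suc)
  then obtain v \<theta> where v: "\<And>n. v n \<in> block_simplex J" "\<And>n. v n \<in> Kpos J"
    and \<theta>: "\<And>n i. 0 < \<theta> n $ i"
    and eig: "\<And>n. F (v n) + ?\<epsilon> n *\<^sub>R ones J = block_scale (\<theta> n) (v n)"
    by metis
  obtain u r where u: "u \<in> block_simplex J" and r: "strict_mono r" "(v \<circ> r) \<longlonglongrightarrow> u"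
    using compact_block_simplex v(1) unfolding compact_def by metis
  have lim_v: "(\<lambda>n. v (r n)) \<longlonglongrightarrow> u" using r(2) by (simp add: o_def)
  have K: "x \<in> Kplus J" if "x \<in> block_simplex J" for x
    using that by (simp add: block_simplex_def)
  have lim_F: "(\<lambda>n. F (v (r n))) \<longlonglongrightarrow> F u"
    using v(1) u K by (intro continuous_on_tendsto_compose[OF cont lim_v]) auto
  have "(\<lambda>n. ?\<epsilon> (r n)) \<longlonglongrightarrow> 0"
    using LIMSEQ_subseq_LIMSEQ[OF LIMSEQ_inverse_real_of_nat r(1)] by (simp add: o_def)
  then have "(\<lambda>n. F (v (r n)) + ?\<epsilon> (r n) *\<^sub>R ones J) \<longlonglongrightarrow> F u + 0 *\<^sub>R ones J"
    by (intro tendsto_intros lim_F)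
  then have lim_G: "(\<lambda>n. block_scale (\<theta> (r n)) (v (r n))) \<longlonglongrightarrow> F u"
    by (simp only: eig scaleR_zero_left add_0_right)
  \<comment> \<open>Points of the block simplex have block sums 1, so the eigenvalues are the block sums of the images.\<close>
  have \<theta>_eq: "\<theta> n = block_sums J (block_scale (\<theta> n) (v n))" for n
    using v(1)[of n] by (simp add: block_sums_block_scale block_simplex_def vec_eq_iff)
  have "(\<lambda>n. block_sums J (block_scale (\<theta> (r n)) (v (r n)))) \<longlonglongrightarrow> block_sums J (F u)"
    unfolding block_sums_def by (intro tendsto_intros tendsto_vec_lambda tendsto_sum tendsto_vec_nth lim_G)
  then have lim_\<theta>: "(\<lambda>n. \<theta> (r n)) \<longlonglongrightarrow> block_sums J (F u)"
    by (simp flip: \<theta>_eq)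
  have "(\<lambda>n. block_scale (\<theta> (r n)) (v (r n))) \<longlonglongrightarrow> block_scale (block_sums J (F u)) u"
    unfolding block_scale_def
    by (intro tendsto_vec_lambda tendsto_scaleR tendsto_vec_nth lim_\<theta> lim_v)
  then have "F u = block_scale (block_sums J (F u)) u"
    using lim_G LIMSEQ_unique by blast
  moreover have "\<forall>i. 0 \<le> block_sums J (F u) $ i"
    using maps[OF K[OF u]] by (auto simp: block_sums_def Kplus_iff intro!: sum_nonneg)
  moreover have "\<exists>v\<in>Kpos J. \<exists>\<theta>. (\<forall>i. 0 < \<theta> $ i) \<and> F v \<le> block_scale \<theta> v \<and> weighted_prod b \<theta> < c"
    if c: "weighted_prod b (block_sums J (F u)) < c" for c
  proof -
    have "(\<lambda>n. weighted_prod b (\<theta> (r n))) \<longlonglongrightarrow> weighted_prod b (block_sums J (F u))"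
      using \<theta> b_pos by (intro tendsto_weighted_prod lim_\<theta>) (auto intro: less_imp_le)
    from order_tendstoD(2)[OF this c] obtain n where n: "weighted_prod b (\<theta> (r n)) < c"
      by (auto simp: eventually_sequentially)
    have "F (v (r n)) \<le> F (v (r n)) + ?\<epsilon> (r n) *\<^sub>R ones J"
      by (auto simp: block_matrix_le_iff ones_def)
    then have "F (v (r n)) \<le> block_scale (\<theta> (r n)) (v (r n))"
      by (simp only: eig)
    then show ?thesis using n \<theta> v(2) by blast
  qed
  ultimately show ?thesis using u that by blast
qed

text \<open>
  Passing to unit norms multiplies the eigenvalue by \<open>\<alpha>\<^sup>A / \<alpha>\<close>, whose weighted geometric mean is 1.
\<close>

lemma unit_eigenvector_with_near_supersolutions:
  obtains u lam where "u \<in> Splus J \<gamma>" "\<forall>i. 0 \<le> lam $ i" "F u = block_scale lam u"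
    "\<And>c. weighted_prod b lam < c \<Longrightarrow> \<exists>v\<in>Kpos J. \<exists>\<theta>. (\<forall>i. 0 < \<theta> $ i) \<and> F v \<le> block_scale \<theta> v \<and>
      weighted_prod b \<theta> < c"
proof -
  obtain u \<mu> where u: "u \<in> block_simplex J" and \<mu>: "\<forall>i. 0 \<le> \<mu> $ i" and eig: "F u = block_scale \<mu> u"
    and near: "\<And>c. weighted_prod b \<mu> < c \<Longrightarrow> \<exists>v\<in>Kpos J. \<exists>\<theta>. (\<forall>i. 0 < \<theta> $ i) \<and>
      F v \<le> block_scale \<theta> v \<and> weighted_prod b \<theta> < c"
    using eigenvector_with_near_supersolutions by metis
  have uK: "u \<in> Kplus J" using u by (simp add: block_simplex_def)
  let ?g = "block_norms \<gamma> u"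
  define \<alpha> where "\<alpha> = (\<chi> i. 1 / ?g $ i)"
  define lam where "lam = vec_powr \<alpha> A * \<mu> * ?g"
  have g: "0 < ?g $ i" for i
    by (rule block_norms_pos[OF uK block_simplex_nonzero[OF u]])
  then have \<alpha>: "\<forall>i. 0 < \<alpha> $ i" by (simp add: \<alpha>_def)
  have inv: "\<alpha> * ?g = 1" using g by (simp add: \<alpha>_def vec_eq_iff less_imp_neq[symmetric])
  have "block_norms \<gamma> (block_scale \<alpha> u) = 1"
    using block_norms_block_scale[OF uK, of \<alpha>] \<alpha> inv by (simp add: less_imp_le)
  then have "block_scale \<alpha> u \<in> Splus J \<gamma>"
    using uK \<alpha> by (auto simp: Splus_iff intro!: Kplus_block_scale less_imp_le)
  moreover have "F (block_scale \<alpha> u) = block_scale lam (block_scale \<alpha> u)"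
  proof -
    have "lam * \<alpha> = vec_powr \<alpha> A * \<mu> * (\<alpha> * ?g)" by (simp add: lam_def mult_ac)
    then have "lam * \<alpha> = vec_powr \<alpha> A * \<mu>" by (simp add: inv)
    then show ?thesis by (simp add: homog[OF uK \<alpha>] eig block_scale_block_scale)
  qed
  moreover have "\<forall>i. 0 \<le> lam $ i"
    using vec_powr_pos[OF \<alpha>] \<mu> g by (simp add: lam_def less_imp_le)
  moreover have "weighted_prod b lam = weighted_prod b \<mu>"
  proof -
    have "weighted_prod b lam = weighted_prod b \<mu> * weighted_prod b (\<alpha> * ?g)"
      by (simp add: lam_def weighted_prod_mult weighted_prod_vec_powr[OF b_fixed \<alpha>])
    then show ?thesis by (simp add: inv weighted_prod_one)
  qed
  ultimately show ?thesis using near that by metis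
qed

text \<open>
  The block scaling of the iterate stays positive even where \<open>\<lambda>\<close> vanishes, because of the summand z in
  \<open>z + F z\<close>.
\<close>

lemma irreducible_eigenvector_pos:
  assumes irr: "irreducible_map J F" and u: "u \<in> Kplus0 J" and lam: "\<forall>i. 0 \<le> lam $ i"
    and eig: "F u = block_scale lam u"
  shows "u \<in> Kpos J"
proof -
  have uK: "u \<in> Kplus J" using u by (simp add: Kplus0_def)
  have "\<exists>\<beta>. (\<forall>i. 0 < \<beta> $ i) \<and> ((\<lambda>z. z + F z) ^^ m) u = block_scale \<beta> u" for m
  proof (induction m)
    case 0
    show ?case by (intro exI[of _ "1"]) (simp add: vec_eq_iff)
  next
    case (Suc m)
    then obtain \<beta> where \<beta>: "\<forall>i. 0 < \<beta> $ i" "((\<lambda>z. z + F z) ^^ m) u = block_scale \<beta> u" by blast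
    have "((\<lambda>z. z + F z) ^^ Suc m) u = block_scale (\<beta> + vec_powr \<beta> A * lam) u"
      by (simp add: \<beta>(2) homog[OF uK \<beta>(1)] eig) (simp add: vec_eq_iff algebra_simps)
    moreover have "\<forall>i. 0 < (\<beta> + vec_powr \<beta> A * lam) $ i"
      using \<beta>(1) vec_powr_pos[OF \<beta>(1)] lam by (simp add: add_pos_nonneg less_imp_le)
    ultimately show ?case by blast
  qed
  moreover obtain m where "((\<lambda>z. z + F z) ^^ m) u \<in> Kpos J"
    using irr u by (auto simp: irreducible_map_def)
  ultimately obtain \<beta> where \<beta>: "\<forall>i. 0 < \<beta> $ i" "block_scale \<beta> u \<in> Kpos J" by metis
  have "0 < u $ i $ j" if "j \<in> J i" for i j
  proof -
    have "0 < \<beta> $ i * u $ i $ j" using \<beta>(2) that by (auto simp: Kpos_iff)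
    then show ?thesis using \<beta>(1) zero_less_mult_pos by blast
  qed
  then show ?thesis using uK by (simp add: Kpos_iff Kplus_iff)
qed

end

section \<open>The spectral radius formulas\<close>

theorem theorem3p3:
  fixes J :: "'d::finite \<Rightarrow> 'n::finite set"
    and \<gamma> :: "'d \<Rightarrow> real^'n \<Rightarrow> real"
    and F :: "real^'n^'d \<Rightarrow> real^'n^'d"
    and A :: "real^'d^'d"
    and b :: "real^'d"
  assumes "\<And>i. J i \<noteq> {}"
    and "\<And>i. monotonic_norm_on (block_space (J i)) (\<gamma> i)"
    and "F \<in> multi_homogeneous_maps J"
    and "multi_homogeneous J F A"
    and "b \<in> pos_simplex"
    and "transpose A *v b = b"
  shows "\<exists>u\<in>Splus J \<gamma>. \<exists>lam :: real^'d.
      (\<forall>i. 0 \<le> lam $ i) \<and>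
      F u = block_scale lam u \<and>
      (SUP x\<in>Kplus0 J. limsup (\<lambda>m. ereal (\<Prod>i\<in>UNIV. \<gamma> i ((F ^^ m) x $ i) powr (b $ i / real m))))
        = ereal (\<Prod>i\<in>UNIV. lam $ i powr b $ i) \<and>
      (\<lambda>m. SUP x\<in>Splus J \<gamma>. ereal (\<Prod>i\<in>UNIV. \<gamma> i ((F ^^ m) x $ i) powr (b $ i / real m)))
        \<longlonglongrightarrow> ereal (\<Prod>i\<in>UNIV. lam $ i powr b $ i) \<and>
      (\<forall>x\<in>Kpos J.
        (\<lambda>m. (\<Prod>i\<in>UNIV. \<gamma> i ((F ^^ m) x $ i) powr b $ i) powr (1 / real m))
          \<longlonglongrightarrow> (\<Prod>i\<in>UNIV. lam $ i powr b $ i)) \<and>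
      (\<forall>y\<in>Splus J \<gamma>. \<forall>\<theta> :: real^'d.
        (\<forall>i. 0 \<le> \<theta> $ i) \<longrightarrow> block_scale \<theta> y \<le> F y \<longrightarrow>
          (\<Prod>i\<in>UNIV. \<theta> $ i powr b $ i) \<le> (\<Prod>i\<in>UNIV. lam $ i powr b $ i)) \<and>
      (irreducible_map J F \<longrightarrow> u \<in> Kpos J)"
proof -
  have maps: "F ` Kplus J \<subseteq> Kplus J" "continuous_on (Kplus J) F" "order_preserving J F"
    using assms(3) by (auto simp: multi_homogeneous_maps_def)
  have "\<And>i. 0 < b $ i" using assms(5) by (simp add: pos_simplex_def)
  then interpret multi_homogeneous_dynamics J \<gamma> F A b
    using assms(1,2,4,6) maps
    by unfold_locales (auto simp: multi_homogeneous_def order_preserving_def)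
  obtain u lam where u: "u \<in> Splus J \<gamma>" and lam: "\<forall>i. 0 \<le> lam $ i" and eig: "F u = block_scale lam u"
    and near: "\<And>c. weighted_prod b lam < c \<Longrightarrow> \<exists>v\<in>Kpos J. \<exists>\<theta>. (\<forall>i. 0 < \<theta> $ i) \<and>
      F v \<le> block_scale \<theta> v \<and> weighted_prod b \<theta> < c"
    using unit_eigenvector_with_near_supersolutions by metis
  let ?\<Lambda> = "weighted_prod b lam"
  have u0: "u \<in> Kplus0 J" using u Splus_subset_Kplus0 by blast
  have S_K: "Splus J \<gamma> \<subseteq> Kplus J" by (auto simp: Splus_def)
  have upper: "\<forall>\<^sub>F m in sequentially. \<forall>x\<in>Kplus J. x \<le> M \<longrightarrow> growth_rate m x < c"
    if M: "M \<in> Kplus J" and c: "?\<Lambda> < c" for M c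
  proof -
    obtain d where d: "?\<Lambda> < d" "d < c" using dense[OF c] by blast
    obtain v \<theta> where v: "v \<in> Kpos J" "\<forall>i. 0 < \<theta> $ i" "F v \<le> block_scale \<theta> v" "weighted_prod b \<theta> < d"
      using near[OF d(1)] by blast
    from growth_rate_le[OF v(1-3) M v(4)] show ?thesis
      by eventually_elim (use d(2) in \<open>auto intro: le_less_trans\<close>)
  qed
  have lower: "?\<Lambda> \<le> growth_rate m u" if "0 < m" for m
    using growth_rate_ge_Splus[OF u lam _ that] eig by simp

  have limsup_le: "limsup (\<lambda>m. ereal (growth_rate m x)) \<le> ereal ?\<Lambda>" if x: "x \<in> Kplus0 J" for x
  proof (rule dense_ge)
    fix a assume "ereal ?\<Lambda> < a"
    then obtain c where c: "?\<Lambda> < c" "ereal c < a"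
      using ereal_dense2 by (metis less_ereal.simps(1))
    have xK: "x \<in> Kplus J" using x by (simp add: Kplus0_def)
    from upper[OF xK c(1)] have "\<forall>\<^sub>F m in sequentially. ereal (growth_rate m x) \<le> a"
    proof eventually_elim
      case (elim m)
      then have "ereal (growth_rate m x) < ereal c" using xK by simp
      then show ?case by (intro less_imp_le less_trans[OF _ c(2)])
    qed
    then show "limsup (\<lambda>m. ereal (growth_rate m x)) \<le> a"
      by (rule Limsup_bounded)
  qed
  have sup_limsup: "(SUP x\<in>Kplus0 J. limsup (\<lambda>m. ereal (growth_rate m x))) = ereal ?\<Lambda>"
  proof (rule antisym)
    show "(SUP x\<in>Kplus0 J. limsup (\<lambda>m. ereal (growth_rate m x))) \<le> ereal ?\<Lambda>"
      by (rule SUP_least[OF limsup_le])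
    have "\<forall>\<^sub>F m in sequentially. ereal ?\<Lambda> \<le> ereal (growth_rate m u)"
      using eventually_gt_at_top[of 0] by eventually_elim (simp add: lower)
    then have "ereal ?\<Lambda> \<le> limsup (\<lambda>m. ereal (growth_rate m u))"
      by (intro le_Limsup) auto
    then show "ereal ?\<Lambda> \<le> (SUP x\<in>Kplus0 J. limsup (\<lambda>m. ereal (growth_rate m x)))"
      by (rule SUP_upper2[OF u0])
  qed

  have lim_sup: "(\<lambda>m. SUP x\<in>Splus J \<gamma>. ereal (growth_rate m x)) \<longlonglongrightarrow> ereal ?\<Lambda>"
  proof (rule order_tendstoI)
    fix a assume a: "a < ereal ?\<Lambda>"
    show "\<forall>\<^sub>F m in sequentially. a < (SUP x\<in>Splus J \<gamma>. ereal (growth_rate m x))"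
      using eventually_gt_at_top[of 0]
    proof eventually_elim
      case (elim m)
      have "ereal ?\<Lambda> \<le> (SUP x\<in>Splus J \<gamma>. ereal (growth_rate m x))"
        using lower[OF elim] by (intro SUP_upper2[OF u]) simp
      with a show ?case by (rule less_le_trans)
    qed
  next
    fix a assume "ereal ?\<Lambda> < a"
    then obtain c where c: "?\<Lambda> < c" "ereal c < a"
      using ereal_dense2 by (metis less_ereal.simps(1))
    obtain M where M: "M \<in> Kplus J" "\<And>x. x \<in> Splus J \<gamma> \<Longrightarrow> x \<le> M"
      using Splus_bounded_above by blast
    from upper[OF M(1) c(1)]
    show "\<forall>\<^sub>F m in sequentially. (SUP x\<in>Splus J \<gamma>. ereal (growth_rate m x)) < a"
    proof eventually_elim
      case (elim m)
      have "(SUP x\<in>Splus J \<gamma>. ereal (growth_rate m x)) \<le> ereal c"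
        using elim M(2) S_K by (intro SUP_least) (auto simp: less_imp_le)
      then show ?case using c(2) by (rule le_less_trans)
    qed
  qed

  have lim_Kpos: "(\<lambda>m. growth_rate m x) \<longlonglongrightarrow> ?\<Lambda>" if x: "x \<in> Kpos J" for x
  proof (rule order_tendstoI)
    fix c assume "c < ?\<Lambda>"
    then show "\<forall>\<^sub>F m in sequentially. c < growth_rate m x"
      using growth_rate_ge_Kpos[OF u lam _ x] eig by simp
  next
    fix c assume c: "?\<Lambda> < c"
    from upper[OF Kpos_imp_Kplus[OF x] c] show "\<forall>\<^sub>F m in sequentially. growth_rate m x < c"
      by eventually_elim (use Kpos_imp_Kplus[OF x] in auto)
  qed

  have collatz_wielandt: "weighted_prod b \<theta> \<le> ?\<Lambda>"
    if y: "y \<in> Splus J \<gamma>" and \<theta>: "\<forall>i. 0 \<le> \<theta> $ i" and sub: "block_scale \<theta> y \<le> F y" for y \<theta>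
  proof (rule ccontr)
    assume "\<not> weighted_prod b \<theta> \<le> ?\<Lambda>"
    then have "?\<Lambda> < weighted_prod b \<theta>" by simp
    from eventually_conj[OF upper[OF _ this, of y] eventually_gt_at_top[of 0]]
    obtain m where m: "growth_rate m y < weighted_prod b \<theta>" "0 < m"
      using y S_K by (auto simp: eventually_sequentially)
    then show False using growth_rate_ge_Splus[OF y \<theta> sub m(2)] by simp
  qed

  have growth_rate_root: "(\<Prod>i\<in>UNIV. \<gamma> i ((F ^^ m) x $ i) powr b $ i) powr (1 / real m) = growth_rate m x" for m x
    by (simp add: growth_rate_def weighted_prod_def block_norms_def)
  show ?thesis
    unfolding growth_rate_root growth_rate_eq_prod[symmetric] weighted_prod_def[symmetric]
  proof (intro bexI[OF _ u] exI[of _ lam] conjI ballI allI impI)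
    show "u \<in> Kpos J" if "irreducible_map J F"
      by (rule irreducible_eigenvector_pos[OF that u0 lam eig])
  qed (use lam eig sup_limsup lim_sup lim_Kpos collatz_wielandt in \<open>simp_all\<close>)
qed

end
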